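(* Suppose $F:\mathbb{R}^d\to\mathbb{R}^d$ is $\mu$-strongly monotone and $1$-symmetric $(L_0,L_1)$-Lipschitz, with $F(x_* )=0$. Then the extragradient method with step sizes $\gamma_k=\omega_k=\frac{\nu}{L_0+L_1\|F(x_k)\|}$, where $\nu>0$ satisfies $1-2\nu-\nu^2\exp(2\nu)=0$, satisfies for all $k\ge0$ $$\|x_{k+1}-x_*\|^2\le\left(1-\frac{\nu\mu}{L_0\left(1+L_1\exp\left(L_1\|x_0-x_*\|\right)\|x_0-x_*\|\right)}\right)^{k+1}\|x_0-x_*\|^2.$$
   Context: Extragradient method (EG): $\hat x_k=x_k-\gamma_kF(x_k)$, $x_{k+1}=x_k-\omega_kF(\hat x_k)$, started from $x_0\in\mathbb{R}^d$. $F$ is $1$-symmetric $(L_0,L_1)$-Lipschitz ($L_0,L_1\ge0$) if for all $x,y$: $\|F(x)-F(y)\|\le\left(L_0+L_1\max_{\theta\in[0,1]}\|F(\theta x+(1-\theta)y)\|\right)\|x-y\|$. $\mu$-strongly monotone ($\mu>0$): $\langle F(x)-F(y),x-y\rangle\ge\mu\|x-y\|^2$ for all $x,y$. *)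

theory Defs
  imports "HOL-Analysis.Analysis"
begin

text \<open>
  The maximum over \<open>\<theta> \<in> [0,1]\<close> in the Lipschitz condition is part of the definition: it is required
  to be attained, and its value is that of the norm at a maximiser \<open>\<theta>\<close>. (A real-valued
  supremum would be unspecified if the norm were unbounded on the segment.)
\<close>

definition symmetric_L0_L1_Lipschitz ::
    "real \<Rightarrow> real \<Rightarrow> ('a::real_normed_vector \<Rightarrow> 'a) \<Rightarrow> bool" where
  "symmetric_L0_L1_Lipschitz L0 L1 F \<longleftrightarrow>
     (\<forall>x y. \<exists>\<theta>. is_arg_max (\<lambda>t. norm (F (t *\<^sub>R x + (1 - t) *\<^sub>R y))) (\<lambda>t. t \<in> {0..1}) \<theta> \<and>
        norm (F x - F y) \<le> (L0 + L1 * norm (F (\<theta> *\<^sub>R x + (1 - \<theta>) *\<^sub>R y))) * norm (x - y))"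

definition strongly_monotone :: "real \<Rightarrow> ('a::real_inner \<Rightarrow> 'a) \<Rightarrow> bool" where
  "strongly_monotone \<mu> F \<longleftrightarrow> (\<forall>x y. (F x - F y) \<bullet> (x - y) \<ge> \<mu> * (norm (x - y))\<^sup>2)"

definition extragradient ::
    "('a::real_vector \<Rightarrow> 'a) \<Rightarrow> (nat \<Rightarrow> real) \<Rightarrow> (nat \<Rightarrow> real) \<Rightarrow> (nat \<Rightarrow> 'a) \<Rightarrow> (nat \<Rightarrow> 'a) \<Rightarrow> bool" where
  "extragradient F \<gamma> \<omega> x xhat \<longleftrightarrow>
     (\<forall>k. xhat k = x k - \<gamma> k *\<^sub>R F (x k) \<and> x (Suc k) = x k - \<omega> k *\<^sub>R F (xhat k))"

end

theory Submission
  imports Defs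
begin

text \<open>
  Write \<open>u x = L0 + L1 * norm (F x)\<close>. The symmetric condition bounds increments of \<open>F\<close> by its size
  somewhere on a segment; the proof first turns this into a bound by the size at an endpoint. On a
  short segment the maximum can be absorbed, at the price of a factor \<open>1 / (1 - L1 * d)\<close> for length
  \<open>d\<close> (\<open>symmetric_Lipschitz_short_segment\<close>). Chaining \<open>n\<close> short segments and letting \<open>n\<close> tend to
  infinity turns these factors into an exponential, a discrete form of Gronwall's inequality
  (\<open>symmetric_Lipschitz_exp\<close>): \<open>norm (F x - F y) \<le> u y * exp (L1 * d) * d\<close> with \<open>d = norm (x - y)\<close>.

  With the step size \<open>\<nu> / u x\<close>, \<open>L1\<close> times the distance from \<open>x\<close> to the extrapolated point is
  at most \<open>\<nu>\<close>, so between these two points \<open>F\<close> changes by at most \<open>\<nu> * exp \<nu> * norm (F x)\<close>.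
  Expanding the squared distance to the solution and using strong monotonicity at the extrapolated
  point leaves, besides the contraction factor \<open>1 - \<gamma> * \<mu>\<close>, at most \<open>\<gamma>\<^sup>2 * (norm (F x))\<^sup>2\<close> times
  \<open>2 * \<gamma> * \<mu> + \<nu>\<^sup>2 * exp (2 * \<nu>) - 1\<close>. The last factor is nonpositive by the equation for \<open>\<nu>\<close>
  because \<open>\<gamma> * \<mu> \<le> \<nu>\<close>, that is \<open>\<mu> \<le> u x\<close>: at infinitesimal scale the Lipschitz bound dominates
  the strong monotonicity bound (\<open>strong_monotonicity_le_local_Lipschitz\<close>). At the solution this
  also says \<open>\<mu> \<le> L0\<close>, so that every denominator is positive.

  Finally the distances to the solution decrease, so the exponential bound based at the solution
  controls \<open>u (x k)\<close> by the initial distance, and the step sizes are bounded below uniformly in \<open>k\<close>.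
\<close>

text \<open>
  Let \<open>z\<close> maximise \<open>norm (F z)\<close> on the segment. The maximum over the segment from \<open>z\<close> to \<open>y\<close> is again
  \<open>norm (F z)\<close>, so the condition applied to \<open>z\<close> and \<open>y\<close> bounds \<open>norm (F z)\<close> in terms of itself with
  the coefficient \<open>L1 * norm (x - y) < 1\<close>, and can be solved for it.
\<close>

lemma symmetric_Lipschitz_short_segment:
  fixes F :: "'a::real_normed_vector \<Rightarrow> 'a"
  assumes L: "L0 \<ge> 0" "L1 \<ge> 0"
    and sym: "symmetric_L0_L1_Lipschitz L0 L1 F"
    and short: "L1 * norm (x - y) < 1"
  shows "norm (F x - F y) \<le> (L0 + L1 * norm (F y)) / (1 - L1 * norm (x - y)) * norm (x - y)"
proof -
  define d where "d = norm (x - y)"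
  obtain \<theta> where \<theta>: "0 \<le> \<theta>" "\<theta> \<le> 1"
    and max: "\<And>t. 0 \<le> t \<Longrightarrow> t \<le> 1 \<Longrightarrow>
        norm (F (t *\<^sub>R x + (1 - t) *\<^sub>R y)) \<le> norm (F (\<theta> *\<^sub>R x + (1 - \<theta>) *\<^sub>R y))"
    and lip: "norm (F x - F y) \<le> (L0 + L1 * norm (F (\<theta> *\<^sub>R x + (1 - \<theta>) *\<^sub>R y))) * d"
    using sym unfolding symmetric_L0_L1_Lipschitz_def is_arg_max_def d_def
    by (metis atLeastAtMost_iff linorder_not_le)
  define z where "z = \<theta> *\<^sub>R x + (1 - \<theta>) *\<^sub>R y"
  define M where "M = norm (F z)"
  obtain \<theta>' where \<theta>': "0 \<le> \<theta>'" "\<theta>' \<le> 1"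
    and lip': "norm (F z - F y) \<le> (L0 + L1 * norm (F (\<theta>' *\<^sub>R z + (1 - \<theta>') *\<^sub>R y))) * norm (z - y)"
    using sym unfolding symmetric_L0_L1_Lipschitz_def is_arg_max_def
    by (metis atLeastAtMost_iff)
  have "\<theta>' *\<^sub>R z + (1 - \<theta>') *\<^sub>R y = (\<theta>' * \<theta>) *\<^sub>R x + (1 - \<theta>' * \<theta>) *\<^sub>R y"
    by (simp add: z_def algebra_simps)
  then have max': "norm (F (\<theta>' *\<^sub>R z + (1 - \<theta>') *\<^sub>R y)) \<le> M"
    using max[of "\<theta>' * \<theta>"] \<theta> \<theta>' by (simp add: M_def z_def mult_le_one)
  have "z - y = \<theta> *\<^sub>R (x - y)"
    by (simp add: z_def algebra_simps)
  then have zy: "norm (z - y) \<le> d"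
    using \<theta> by (simp add: d_def mult_left_le_one_le)
  have "norm (F z - F y) \<le> (L0 + L1 * M) * d"
    using L max' zy by (intro order_trans[OF lip'] mult_mono add_mono mult_left_mono) (auto simp: M_def)
  then have "M \<le> norm (F y) + (L0 + L1 * M) * d"
    unfolding M_def using norm_triangle_sub[of "F z" "F y"] by linarith
  then have "L1 * M \<le> L1 * (norm (F y) + (L0 + L1 * M) * d)"
    using L by (intro mult_left_mono)
  then have "(L0 + L1 * M) * (1 - L1 * d) \<le> L0 + L1 * norm (F y)"
    by (simp add: algebra_simps)
  then have "L0 + L1 * M \<le> (L0 + L1 * norm (F y)) / (1 - L1 * d)"
    using short by (simp add: d_def pos_le_divide_eq)
  then show ?thesis
    using lip mult_right_mono[of "L0 + L1 * M" _ d] by (force simp: d_def M_def z_def)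
qed

text \<open>
  Cut the segment into \<open>n\<close> equal pieces of length \<open>d / n\<close>. With \<open>q = 1 / (1 - L1 * d / n)\<close>, each piece
  multiplies \<open>L0 + L1 * norm (F p)\<close> by at most \<open>q\<close>, since \<open>1 + q * (L1 * d / n) = q\<close>. Summing the
  increments gives the factor \<open>q ^ n\<close>, which tends to \<open>exp (L1 * d)\<close>.
\<close>

lemma symmetric_Lipschitz_exp:
  fixes F :: "'a::real_normed_vector \<Rightarrow> 'a"
  assumes L: "L0 \<ge> 0" "L1 \<ge> 0"
    and sym: "symmetric_L0_L1_Lipschitz L0 L1 F"
  shows "norm (F x - F y) \<le> (L0 + L1 * norm (F y)) * exp (L1 * norm (x - y)) * norm (x - y)"
proof -
  define d where "d = norm (x - y)"
  define u where "u = (\<lambda>z. L0 + L1 * norm (F z))"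
  have u0: "u z \<ge> 0" for z
    using L by (simp add: u_def)
  have d0: "d \<ge> 0"
    by (simp add: d_def)
  have bound: "norm (F x - F y) \<le> u y * inverse ((1 + (- (L1 * d)) / real n) ^ n) * d"
    if n: "real n > L1 * d" for n
  proof -
    have n0: "real n > 0"
      using n L d0 by (meson le_less_trans mult_nonneg_nonneg)
    define a where "a = L1 * d / real n"
    define q where "q = 1 / (1 - a)"
    define p where "p i = y + (real i / real n) *\<^sub>R (x - y)" for i :: nat
    have a: "0 \<le> a" "a < 1"
      using n n0 L d0 by (auto simp: a_def)
    have q: "q \<ge> 1" "1 + q * a = q"
      using a by (auto simp: q_def field_simps)
    have piece: "norm (p (Suc i) - p i) = d / real n" for i
    proof -
      have "p (Suc i) - p i = (1 / real n) *\<^sub>R (x - y)"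
        by (simp add: p_def add_divide_distrib scaleR_add_left)
      then show ?thesis
        using n0 by (simp add: d_def)
    qed
    have inc: "norm (F (p (Suc i)) - F (p i)) \<le> u (p i) * q * (d / real n)" for i
      using symmetric_Lipschitz_short_segment[OF L sym, of "p (Suc i)" "p i"] a
      by (simp add: piece u_def q_def a_def)
    have grow: "u (p i) \<le> q ^ i * u y" for i
    proof (induction i)
      case 0
      then show ?case by (simp add: p_def)
    next
      case (Suc i)
      have "norm (F (p (Suc i))) \<le> norm (F (p i)) + u (p i) * q * (d / real n)"
        using inc[of i] norm_triangle_sub[of "F (p (Suc i))" "F (p i)"] by linarith
      then have "u (p (Suc i)) \<le> L0 + L1 * (norm (F (p i)) + u (p i) * q * (d / real n))"
        using L by (auto simp: u_def intro: mult_left_mono)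
      also have "\<dots> = u (p i) * (1 + q * a)"
        by (simp add: u_def a_def algebra_simps add_divide_distrib)
      also have "\<dots> = q * u (p i)"
        using q by simp
      also have "\<dots> \<le> q * (q ^ i * u y)"
        using Suc q by (intro mult_left_mono) auto
      finally show ?case by simp
    qed
    have total: "norm (F (p i) - F y) \<le> real i * (q ^ i * u y * (d / real n))" for i
    proof (induction i)
      case 0
      then show ?case by (simp add: p_def)
    next
      case (Suc i)
      let ?c = "u y * (d / real n)"
      have c: "?c \<ge> 0"
        using u0 d0 n0 by simp
      have "norm (F (p (Suc i)) - F y) \<le> norm (F (p (Suc i)) - F (p i)) + norm (F (p i) - F y)"
        by (metis norm_triangle_ineq add_diff_eq diff_add_cancel)
      also have "norm (F (p (Suc i)) - F (p i)) \<le> (q ^ i * u y) * q * (d / real n)"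
        using grow[of i] q d0 n0 by (intro order_trans[OF inc] mult_right_mono) auto
      also have "\<dots> = q ^ Suc i * ?c"
        by simp
      also have "norm (F (p i) - F y) \<le> real i * (q ^ Suc i * ?c)"
      proof -
        have "real i * (q ^ i * ?c) \<le> real i * (q ^ Suc i * ?c)"
          using q c by (intro mult_left_mono mult_right_mono power_increasing) auto
        then show ?thesis
          using Suc by (simp add: mult.assoc)
      qed
      finally show ?case
        by (simp add: algebra_simps add_divide_distrib)
    qed
    have "p n = x"
      using n0 by (simp add: p_def)
    then have "norm (F x - F y) \<le> u y * q ^ n * d"
      using total[of n] n0 by (simp add: mult_ac)
    then show ?thesis
      by (simp add: q_def a_def power_one_over inverse_eq_divide)
  qed
  have "(\<lambda>n. u y * inverse ((1 + (- (L1 * d)) / real n) ^ n) * d)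
      \<longlonglongrightarrow> u y * inverse (exp (- (L1 * d))) * d"
    by (intro tendsto_intros tendsto_exp_limit_sequentially) simp
  moreover have "\<forall>\<^sub>F n in sequentially. real n > L1 * d"
    by (metis eventually_gt_at_top filterlim_iff filterlim_real_sequentially)
  then have "\<forall>\<^sub>F n in sequentially. norm (F x - F y)
      \<le> u y * inverse ((1 + (- (L1 * d)) / real n) ^ n) * d"
    by eventually_elim (rule bound)
  ultimately have "norm (F x - F y) \<le> u y * inverse (exp (- (L1 * d))) * d"
    by (intro tendsto_lowerbound) auto
  then show ?thesis
    by (simp add: u_def d_def exp_minus)
qed

text \<open>
  Compare the two bounds on \<open>F x - F y\<close> as \<open>x\<close> tends to \<open>y\<close> along a basis vector: the exponential
  factor tends to \<open>1\<close>.
\<close>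

lemma strong_monotonicity_le_local_Lipschitz:
  fixes F :: "'a::euclidean_space \<Rightarrow> 'a"
  assumes L: "L0 \<ge> 0" "L1 \<ge> 0"
    and sym: "symmetric_L0_L1_Lipschitz L0 L1 F"
    and mono: "strongly_monotone \<mu> F"
  shows "\<mu> \<le> L0 + L1 * norm (F y)"
proof -
  obtain b :: 'a where b: "b \<in> Basis"
    using nonempty_Basis by blast
  have bound: "\<mu> \<le> (L0 + L1 * norm (F y)) * exp (L1 * t)" if t: "t > 0" for t
  proof -
    define x where "x = y + t *\<^sub>R b"
    have d: "norm (x - y) = t"
      using t b by (simp add: x_def)
    have "\<mu> * t\<^sup>2 \<le> (F x - F y) \<bullet> (x - y)"
      using mono d unfolding strongly_monotone_def by metis
    also have "\<dots> \<le> norm (F x - F y) * t"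
      using norm_cauchy_schwarz[of "F x - F y" "x - y"] d by simp
    also have "\<dots> \<le> ((L0 + L1 * norm (F y)) * exp (L1 * t) * t) * t"
      using symmetric_Lipschitz_exp[OF L sym, of x y] d t by (intro mult_right_mono) auto
    finally show ?thesis
      using t by (simp add: power2_eq_square)
  qed
  have "((\<lambda>t. (L0 + L1 * norm (F y)) * exp (L1 * t)) \<longlongrightarrow> (L0 + L1 * norm (F y)) * exp (L1 * 0))
      (at_right 0)"
    by (intro tendsto_intros)
  moreover have "\<forall>\<^sub>F t in at_right (0::real). \<mu> \<le> (L0 + L1 * norm (F y)) * exp (L1 * t)"
    using eventually_at_right_less by (rule eventually_mono) (rule bound)
  ultimately have "\<mu> \<le> (L0 + L1 * norm (F y)) * exp (L1 * 0)"
    by (intro tendsto_lowerbound) auto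
  then show ?thesis by simp
qed

text \<open>
  Strong monotonicity is available at the extrapolated point \<open>xh\<close>, but the contraction is wanted
  at \<open>x\<close>. The parallelogram-type inequality
  \<open>(norm (x - s))\<^sup>2 / 2 \<le> (norm (xh - s))\<^sup>2 + (norm (x - xh))\<^sup>2\<close> transfers it, which halves the rate
  \<open>2 * \<gamma> * \<mu>\<close> and produces the term \<open>2 * \<gamma> * \<mu> * \<gamma>\<^sup>2 * (norm (F x))\<^sup>2\<close>.
\<close>

lemma extragradient_step_contraction:
  fixes F :: "'a::euclidean_space \<Rightarrow> 'a"
  assumes L: "L0 \<ge> 0" "L1 \<ge> 0"
    and sym: "symmetric_L0_L1_Lipschitz L0 L1 F"
    and \<mu>: "\<mu> > 0"
    and mono: "strongly_monotone \<mu> F"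
    and root: "F s = 0"
    and \<nu>: "\<nu> > 0" "1 - 2 * \<nu> - \<nu>\<^sup>2 * exp (2 * \<nu>) = 0"
    and g: "g = \<nu> / (L0 + L1 * norm (F x))"
    and xh: "xh = x - g *\<^sub>R F x"
  shows "(norm (x - g *\<^sub>R F xh - s))\<^sup>2 \<le> (1 - g * \<mu>) * (norm (x - s))\<^sup>2"
proof -
  define u where "u = L0 + L1 * norm (F x)"
  have \<mu>u: "\<mu> \<le> u"
    unfolding u_def by (rule strong_monotonicity_le_local_Lipschitz[OF L sym mono])
  then have u: "u > 0"
    using \<mu> by simp
  have gu: "g * u = \<nu>"
    using u by (simp add: g u_def)
  have g0: "g > 0"
    using u \<nu> by (simp add: g u_def)
  have g\<mu>: "g * \<mu> \<le> \<nu>"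
    using mult_left_mono[OF \<mu>u, of g] g0 gu by simp
  have dist: "norm (xh - x) = g * norm (F x)"
    using g0 by (simp add: xh)
  have "L1 * norm (F x) \<le> u"
    using L by (simp add: u_def)
  then have "g * (L1 * norm (F x)) \<le> g * u"
    using g0 by simp
  then have exponent: "L1 * norm (xh - x) \<le> \<nu>"
    using gu dist by (simp add: mult_ac)
  have "norm (F xh - F x) \<le> u * exp (L1 * norm (xh - x)) * norm (xh - x)"
    unfolding u_def by (rule symmetric_Lipschitz_exp[OF L sym])
  also have "\<dots> \<le> u * exp \<nu> * norm (xh - x)"
    using exponent u by (intro mult_right_mono mult_left_mono) auto
  also have "\<dots> = \<nu> * exp \<nu> * norm (F x)"
    using dist gu by (metis mult.assoc mult.commute)
  finally have "(norm (F xh - F x))\<^sup>2 \<le> (\<nu> * exp \<nu> * norm (F x))\<^sup>2"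
    by (intro power_mono) auto
  also have "\<dots> = \<nu>\<^sup>2 * exp (2 * \<nu>) * (norm (F x))\<^sup>2"
    by (simp add: power_mult_distrib exp_double)
  also have "\<dots> = (1 - 2 * \<nu>) * (norm (F x))\<^sup>2"
  proof -
    have "\<nu>\<^sup>2 * exp (2 * \<nu>) = 1 - 2 * \<nu>"
      using \<nu> by linarith
    then show ?thesis by simp
  qed
  also have "\<dots> \<le> (1 - 2 * (g * \<mu>)) * (norm (F x))\<^sup>2"
    using g\<mu> by (intro mult_right_mono) auto
  finally have var: "g\<^sup>2 * (norm (F xh - F x))\<^sup>2 \<le> g\<^sup>2 * ((1 - 2 * (g * \<mu>)) * (norm (F x))\<^sup>2)"
    by (intro mult_left_mono) auto
  have "\<mu> * (norm (xh - s))\<^sup>2 \<le> F xh \<bullet> (xh - s)"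
    using mono root unfolding strongly_monotone_def by (metis diff_zero)
  moreover have "(norm (x - s))\<^sup>2 / 2 - g\<^sup>2 * (norm (F x))\<^sup>2 \<le> (norm (xh - s))\<^sup>2"
  proof -
    have "0 \<le> (norm ((x - s) - (2 * g) *\<^sub>R F x))\<^sup>2"
      by simp
    then show ?thesis
      unfolding xh power2_norm_eq_inner
      by (simp add: algebra_simps inner_commute power2_eq_square add_divide_distrib diff_divide_distrib)
  qed
  then have "\<mu> * ((norm (x - s))\<^sup>2 / 2 - g\<^sup>2 * (norm (F x))\<^sup>2) \<le> \<mu> * (norm (xh - s))\<^sup>2"
    using \<mu> by (intro mult_left_mono) auto
  ultimately have "\<mu> * ((norm (x - s))\<^sup>2 / 2 - g\<^sup>2 * (norm (F x))\<^sup>2) \<le> F xh \<bullet> (xh - s)"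
    by linarith
  then have descent: "2 * g * (\<mu> * ((norm (x - s))\<^sup>2 / 2 - g\<^sup>2 * (norm (F x))\<^sup>2))
      \<le> 2 * g * (F xh \<bullet> (xh - s))"
    using g0 by (intro mult_left_mono) auto
  have "(norm (x - g *\<^sub>R F xh - s))\<^sup>2
      = (norm (x - s))\<^sup>2 - 2 * g * (F xh \<bullet> (xh - s)) + g\<^sup>2 * (norm (F xh - F x))\<^sup>2
        - g\<^sup>2 * (norm (F x))\<^sup>2"
  proof -
    have "(norm ((x - s) - g *\<^sub>R h))\<^sup>2
        = (norm (x - s))\<^sup>2 - 2 * g * (h \<bullet> ((x - s) - g *\<^sub>R F x)) + g\<^sup>2 * (norm (h - F x))\<^sup>2
          - g\<^sup>2 * (norm (F x))\<^sup>2" for h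
      unfolding power2_norm_eq_inner
      by (simp add: algebra_simps inner_commute power2_eq_square)
    from this[of "F xh"] show ?thesis
      by (simp add: xh algebra_simps)
  qed
  also have "\<dots> \<le> (norm (x - s))\<^sup>2 - 2 * g * (\<mu> * ((norm (x - s))\<^sup>2 / 2 - g\<^sup>2 * (norm (F x))\<^sup>2))
      + g\<^sup>2 * ((1 - 2 * (g * \<mu>)) * (norm (F x))\<^sup>2) - g\<^sup>2 * (norm (F x))\<^sup>2"
    using var descent by linarith
  also have "\<dots> = (1 - g * \<mu>) * (norm (x - s))\<^sup>2"
    by (simp add: algebra_simps power2_eq_square)
  finally show ?thesis .
qed

theorem theorem4p2:
  fixes F :: "real ^ 'd \<Rightarrow> real ^ 'd"
    and x xhat :: "nat \<Rightarrow> real ^ 'd"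
    and xstar :: "real ^ 'd"
    and \<gamma> \<omega> :: "nat \<Rightarrow> real"
    and L0 L1 \<mu> \<nu> :: real
  assumes "L0 \<ge> 0" and "L1 \<ge> 0"
    and "\<mu> > 0"
    and "strongly_monotone \<mu> F"
    and "symmetric_L0_L1_Lipschitz L0 L1 F"
    and "F xstar = 0"
    and "\<nu> > 0"
    and "1 - 2 * \<nu> - \<nu>\<^sup>2 * exp (2 * \<nu>) = 0"
    and "extragradient F \<gamma> \<omega> x xhat"
    and "\<And>k. \<gamma> k = \<nu> / (L0 + L1 * norm (F (x k)))"
    and "\<And>k. \<omega> k = \<nu> / (L0 + L1 * norm (F (x k)))"
  shows "\<forall>k. (norm (x (k + 1) - xstar))\<^sup>2
      \<le> (1 - \<nu> * \<mu> / (L0 * (1 + L1 * exp (L1 * norm (x 0 - xstar)) * norm (x 0 - xstar)))) ^ (k + 1)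
         * (norm (x 0 - xstar))\<^sup>2"
proof -
  note L = assms(1,2) and \<mu> = assms(3) and mono = assms(4) and sym = assms(5) and root = assms(6)
  define D where "D = norm (x 0 - xstar)"
  define R where "R = L0 * (1 + L1 * exp (L1 * D) * D)"
  define \<rho> where "\<rho> = 1 - \<nu> * \<mu> / R"
  have "\<mu> \<le> L0"
    using strong_monotonicity_le_local_Lipschitz[OF L sym mono, of xstar] root by simp
  then have L0: "L0 > 0"
    using \<mu> by simp
  have step: "(norm (x (Suc k) - xstar))\<^sup>2 \<le> (1 - \<gamma> k * \<mu>) * (norm (x k - xstar))\<^sup>2" for k
  proof -
    have "xhat k = x k - \<gamma> k *\<^sub>R F (x k)" "x (Suc k) = x k - \<gamma> k *\<^sub>R F (xhat k)"
      using assms(9-11) by (auto simp: extragradient_def)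
    then show ?thesis
      using extragradient_step_contraction[OF L sym \<mu> mono root assms(7,8) assms(10)] by metis
  qed
  have \<gamma>0: "\<gamma> k \<ge> 0" for k
    using assms(1,2,7,10) by simp
  have near: "norm (x k - xstar) \<le> D" for k
  proof (induction k)
    case 0
    then show ?case by (simp add: D_def)
  next
    case (Suc k)
    have "(1 - \<gamma> k * \<mu>) * (norm (x k - xstar))\<^sup>2 \<le> 1 * (norm (x k - xstar))\<^sup>2"
      using \<gamma>0[of k] \<mu> by (intro mult_right_mono) auto
    then have "(norm (x (Suc k) - xstar))\<^sup>2 \<le> (norm (x k - xstar))\<^sup>2"
      using step[of k] by linarith
    then show ?case
      using Suc by (meson norm_ge_zero order_trans power2_le_imp_le)
  qed
  have contract: "(norm (x (Suc k) - xstar))\<^sup>2 \<le> \<rho> * (norm (x k - xstar))\<^sup>2" for k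
  proof -
    have "norm (F (x k)) \<le> L0 * exp (L1 * norm (x k - xstar)) * norm (x k - xstar)"
      using symmetric_Lipschitz_exp[OF L sym, of "x k" xstar] root by simp
    also have "\<dots> \<le> L0 * exp (L1 * D) * D"
      using near[of k] L by (intro mult_mono) (auto intro: mult_left_mono)
    finally have "L1 * norm (F (x k)) \<le> L1 * (L0 * exp (L1 * D) * D)"
      using L by (intro mult_left_mono)
    then have "L0 + L1 * norm (F (x k)) \<le> R"
      by (simp add: R_def algebra_simps)
    moreover have "L0 + L1 * norm (F (x k)) > 0"
      using L L0 by (simp add: add_pos_nonneg)
    ultimately have "\<nu> / R \<le> \<gamma> k"
      using assms(7,10) by (simp add: frac_le)
    then have "1 - \<gamma> k * \<mu> \<le> \<rho>"
      using mult_right_mono[of "\<nu> / R" "\<gamma> k" \<mu>] \<mu> by (simp add: \<rho>_def)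
    then show ?thesis
      using step[of k] by (meson mult_right_mono order_trans zero_le_power2)
  qed
  have "(norm (x (Suc k) - xstar))\<^sup>2 \<le> \<rho> ^ Suc k * D\<^sup>2" for k
  proof (cases "D = 0")
    case True
    then show ?thesis
      using near[of "Suc k"] by simp
  next
    case False
    \<comment> \<open>Iterating needs a nonnegative rate, and the first step from a point other than the solution
      forces it.\<close>
    have "0 \<le> \<rho> * D\<^sup>2"
      using contract[of 0] unfolding D_def by (meson order_trans zero_le_power2)
    then have \<rho>: "\<rho> \<ge> 0"
      using False by (simp add: zero_le_mult_iff)
    show ?thesis
    proof (induction k)
      case 0
      then show ?case
        using contract[of 0] by (simp add: D_def)
    next
      case (Suc k)
      have "(norm (x (Suc (Suc k)) - xstar))\<^sup>2 \<le> \<rho> * (\<rho> ^ Suc k * D\<^sup>2)"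
        using contract[of "Suc k"] mult_left_mono[OF Suc \<rho>] by linarith
      then show ?case by simp
    qed
  qed
  then show ?thesis
    by (simp add: \<rho>_def R_def D_def)
qed

end
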